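(* Let $0<q<1$, $a>0$, $0<\alpha<1$, let $p,r,w_\alpha$ be real-valued functions on $A_{q,a}^*$ with $p(x)\neq0$ and $w_\alpha(x)>0$ for all $x\in A_{q,a}^*$, and let $c_1,c_2,d_1,d_2$ be real with $c_1^2+c_2^2\ne0$, $d_1^2+d_2^2\neq0$. If $u$ and $v$ are eigenfunctions of the regular $q$-fractional Sturm--Liouville problem $$D_{q,a^-}^{\alpha}\big(p\,{}^cD_{q,0^+}^{\alpha}y\big)(x)+r(x)y(x)-\lambda w_\alpha(x)y(x)=0,\quad x\in A_{q,a}^*,$$ $$c_1y(0)+c_2\big[I_{q,a^-}^{1-\alpha}\,p\,{}^cD_{q,0^+}^{\alpha}y\big](0)=0,\qquad d_1y(a)+d_2\big[I_{q,a^-}^{1-\alpha}\,p\,{}^cD_{q,0^+}^{\alpha}y\big]\left(\tfrac aq\right)=0,$$ associated with different eigenvalues $\lambda$ and $\mu$, then $u$ and $v$ are orthogonal in the weighted space $L_q^2(A_{q,a}^*,w_\alpha)$.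
   Context: Notation: $A_{q,a}=\{aq^n:n\in\mathbb{N}_0\}$, $A_{q,a}^*=A_{q,a}\cup\{0\}$; $(z;q)_\infty=\prod_{k\ge 0}(1-zq^k)$; $(z;q)_\nu=(z;q)_\infty/(zq^{\nu};q)_\infty$; $\Gamma_q(\nu)=\frac{(q;q)_\infty}{(q^\nu;q)_\infty}(1-q)^{1-\nu}$. Jackson integral: $\int_0^x f(t)\,d_qt=(1-q)\sum_{n\ge 0}xq^nf(xq^n)$, $\int_c^d=\int_0^d-\int_0^c$. $D_qf(x)=\frac{f(x)-f(qx)}{(1-q)x}$, $D_{q^{-1}}f(x)=\frac{f(x)-f(x/q)}{(1-q^{-1})x}$ for $x\neq0$ (values at $0$ are limits along $A_{q,a}$). $f$ is $q$-regular at zero if $\lim_{n\to\infty}f(xq^n)=f(0)$ for all $x\in A_{q,a}^*$. Operators: $$I_{q,0^+}^{\nu}f(x)=\frac{x^{\nu-1}}{\Gamma_q(\nu)}\int_0^x(qt/x;q)_{\nu-1}f(t)\,d_qt,\qquad I_{q,a^-}^{\nu}f(x)=\frac{1}{\Gamma_q(\nu)}\int_{qx}^{a}t^{\nu-1}(qx/t;q)_{\nu-1}f(t)\,d_qt,$$ $${}^cD_{q,0^+}^\alpha f=I_{q,0^+}^{1-\alpha}D_qf,\qquad D_{q,a^-}^\alpha f=-\tfrac1qD_{q^{-1}}I_{q,a^-}^{1-\alpha}f .$$ $[h](a/q)$ denotes the value of $h$ at $x=a/q$. A complex number $\lambda$ is an eigenvalue if the boundary value problem has a non-trivial solution $y$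 (an eigenfunction); solutions are sought among functions in $L_q^2(A_{q,a}^* )$ (i.e. $\int_0^a|y|^2d_qu<\infty$) which are $q$-regular at zero. The inner product of $L_q^2(A_{q,a}^*,w_\alpha)$ is $\langle f,g\rangle=\int_0^af(u)\overline{g(u)}w_\alpha(u)\,d_qu$. *)

theory Defs
  imports "HOL-Analysis.Analysis"
begin

definition Aq :: "real \<Rightarrow> real \<Rightarrow> real set" where
  "Aq q a = {a * q ^ n | n. n \<in> (UNIV :: nat set)}"

definition Aq_star :: "real \<Rightarrow> real \<Rightarrow> real set" where
  "Aq_star q a = insert 0 (Aq q a)"

text \<open>
  Functions on \<open>Aq_star q a\<close> are modelled as total functions on the reals; nothing below
  inspects the given data outside \<open>Aq_star q a\<close>.
\<close>

subsection \<open>q-shifted factorials and the q-Gamma function\<close>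

definition qpoch_inf :: "real \<Rightarrow> real \<Rightarrow> real" where
  "qpoch_inf z q = prodinf (\<lambda>k. 1 - z * q ^ k)"

definition qpoch :: "real \<Rightarrow> real \<Rightarrow> real \<Rightarrow> real" where
  "qpoch z q \<nu> = qpoch_inf z q / qpoch_inf (z * q powr \<nu>) q"

definition q_Gamma :: "real \<Rightarrow> real \<Rightarrow> real" where
  "q_Gamma q \<nu> = qpoch_inf q q / qpoch_inf (q powr \<nu>) q * (1 - q) powr (1 - \<nu>)"

subsection \<open>Jackson integral and q-derivatives\<close>

text \<open>
  The series is an ordered series (limit of partial sums); absolute convergence is not required.
\<close>

definition jackson_integrable0 :: "real \<Rightarrow> real \<Rightarrow> (real \<Rightarrow> complex) \<Rightarrow> bool" where
  "jackson_integrable0 q x f \<longleftrightarrow> summable (\<lambda>n. of_real (x * q ^ n) * f (x * q ^ n))"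

definition jackson_integral0 :: "real \<Rightarrow> real \<Rightarrow> (real \<Rightarrow> complex) \<Rightarrow> complex" where
  "jackson_integral0 q x f = of_real (1 - q) * (\<Sum>n. of_real (x * q ^ n) * f (x * q ^ n))"

definition jackson_integrable :: "real \<Rightarrow> real \<Rightarrow> real \<Rightarrow> (real \<Rightarrow> complex) \<Rightarrow> bool" where
  "jackson_integrable q c d f \<longleftrightarrow> jackson_integrable0 q c f \<and> jackson_integrable0 q d f"

definition jackson_integral :: "real \<Rightarrow> real \<Rightarrow> real \<Rightarrow> (real \<Rightarrow> complex) \<Rightarrow> complex" where
  "jackson_integral q c d f = jackson_integral0 q d f - jackson_integral0 q c f"

definition q_quotient :: "real \<Rightarrow> (real \<Rightarrow> complex) \<Rightarrow> real \<Rightarrow> complex" where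
  "q_quotient b f x = (f x - f (b * x)) / of_real ((1 - b) * x)"

definition Dq :: "real \<Rightarrow> real \<Rightarrow> (real \<Rightarrow> complex) \<Rightarrow> real \<Rightarrow> complex" where
  "Dq q a f x = (if x = 0 then lim (\<lambda>n. q_quotient q f (a * q ^ n)) else q_quotient q f x)"

definition Dq_inv :: "real \<Rightarrow> real \<Rightarrow> (real \<Rightarrow> complex) \<Rightarrow> real \<Rightarrow> complex" where
  "Dq_inv q a f x =
     (if x = 0 then lim (\<lambda>n. q_quotient (1 / q) f (a * q ^ n)) else q_quotient (1 / q) f x)"

definition q_regular_at_zero :: "real \<Rightarrow> real \<Rightarrow> (real \<Rightarrow> complex) \<Rightarrow> bool" where
  "q_regular_at_zero q a f \<longleftrightarrow> (\<forall>x\<in>Aq_star q a. (\<lambda>n. f (x * q ^ n)) \<longlonglongrightarrow> f 0)"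

definition in_Lq2 :: "real \<Rightarrow> real \<Rightarrow> (real \<Rightarrow> complex) \<Rightarrow> bool" where
  "in_Lq2 q a f \<longleftrightarrow> jackson_integrable0 q a (\<lambda>t. of_real ((cmod (f t))\<^sup>2))"

subsection \<open>q-fractional operators\<close>

definition left_integrand :: "real \<Rightarrow> real \<Rightarrow> (real \<Rightarrow> complex) \<Rightarrow> real \<Rightarrow> real \<Rightarrow> complex" where
  "left_integrand q \<nu> f x t = of_real (qpoch (q * t / x) q (\<nu> - 1)) * f t"

text \<open>
  The formula for the left integral has no meaning at \<open>x = 0\<close>; there the value is the limit
  along \<open>Aq q a\<close>, as for the q-derivatives. (The boundary value problem below
  only uses left integrals at points of \<open>Aq q a\<close>.)
\<close>

definition I_left_formula :: "real \<Rightarrow> real \<Rightarrow> (real \<Rightarrow> complex) \<Rightarrow> real \<Rightarrow> complex" where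
  "I_left_formula q \<nu> f x =
     of_real (x powr (\<nu> - 1) / q_Gamma q \<nu>) * jackson_integral0 q x (left_integrand q \<nu> f x)"

definition I_left :: "real \<Rightarrow> real \<Rightarrow> real \<Rightarrow> (real \<Rightarrow> complex) \<Rightarrow> real \<Rightarrow> complex" where
  "I_left q a \<nu> f x =
     (if x = 0 then lim (\<lambda>n. I_left_formula q \<nu> f (a * q ^ n)) else I_left_formula q \<nu> f x)"

definition right_integrand :: "real \<Rightarrow> real \<Rightarrow> (real \<Rightarrow> complex) \<Rightarrow> real \<Rightarrow> real \<Rightarrow> complex" where
  "right_integrand q \<nu> f x t = of_real (t powr (\<nu> - 1) * qpoch (q * x / t) q (\<nu> - 1)) * f t"

definition I_right :: "real \<Rightarrow> real \<Rightarrow> real \<Rightarrow> (real \<Rightarrow> complex) \<Rightarrow> real \<Rightarrow> complex" where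
  "I_right q a \<nu> f x =
     of_real (1 / q_Gamma q \<nu>) * jackson_integral q (q * x) a (right_integrand q \<nu> f x)"

definition cD_left :: "real \<Rightarrow> real \<Rightarrow> real \<Rightarrow> (real \<Rightarrow> complex) \<Rightarrow> real \<Rightarrow> complex" where
  "cD_left q a \<alpha> f = I_left q a (1 - \<alpha>) (Dq q a f)"

definition D_right :: "real \<Rightarrow> real \<Rightarrow> real \<Rightarrow> (real \<Rightarrow> complex) \<Rightarrow> real \<Rightarrow> complex" where
  "D_right q a \<alpha> f x = - of_real (1 / q) * Dq_inv q a (I_right q a (1 - \<alpha>) f) x"

subsection \<open>The q-fractional Sturm--Liouville problem\<close>

definition p_cD ::
  "real \<Rightarrow> real \<Rightarrow> real \<Rightarrow> (real \<Rightarrow> real) \<Rightarrow> (real \<Rightarrow> complex) \<Rightarrow> real \<Rightarrow> complex" where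
  "p_cD q a \<alpha> p y x = of_real (p x) * cD_left q a \<alpha> y x"

text \<open>
  Series and limits are total functions in HOL, so it has to be said that the ones occurring in
  the problem converge: the series of the left integral on \<open>Aq q a\<close>, the series of the right
  integral on \<open>Aq_star q a\<close>, and the limit that defines the value at \<open>0\<close> of its derivative. Only the
  limit and the right series at \<open>0\<close> are genuine conditions: on \<open>Aq q a\<close> the left series
  converges by q-regularity of \<open>y\<close> and the right one has finitely many nonzero terms.
\<close>

definition qfsl_defined ::
  "real \<Rightarrow> real \<Rightarrow> real \<Rightarrow> (real \<Rightarrow> real) \<Rightarrow> (real \<Rightarrow> complex) \<Rightarrow> bool" where
  "qfsl_defined q a \<alpha> p y \<longleftrightarrow>
     (\<forall>x\<in>Aq q a. jackson_integrable0 q x (left_integrand q (1 - \<alpha>) (Dq q a y) x)) \<and>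
     (\<forall>x\<in>Aq_star q a.
        jackson_integrable q (q * x) a (right_integrand q (1 - \<alpha>) (p_cD q a \<alpha> p y) x)) \<and>
     convergent (\<lambda>n. q_quotient (1 / q) (I_right q a (1 - \<alpha>) (p_cD q a \<alpha> p y)) (a * q ^ n))"

definition qfsl_solution ::
  "real \<Rightarrow> real \<Rightarrow> real \<Rightarrow> (real \<Rightarrow> real) \<Rightarrow> (real \<Rightarrow> real) \<Rightarrow> (real \<Rightarrow> real) \<Rightarrow>
   real \<Rightarrow> real \<Rightarrow> real \<Rightarrow> real \<Rightarrow> complex \<Rightarrow> (real \<Rightarrow> complex) \<Rightarrow> bool" where
  "qfsl_solution q a \<alpha> p r w c1 c2 d1 d2 lam y \<longleftrightarrow>
     in_Lq2 q a y \<and> q_regular_at_zero q a y \<and> qfsl_defined q a \<alpha> p y \<and>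
     (\<forall>x\<in>Aq_star q a.
        D_right q a \<alpha> (p_cD q a \<alpha> p y) x + of_real (r x) * y x - lam * of_real (w x) * y x = 0) \<and>
     of_real c1 * y 0 + of_real c2 * I_right q a (1 - \<alpha>) (p_cD q a \<alpha> p y) 0 = 0 \<and>
     of_real d1 * y a + of_real d2 * I_right q a (1 - \<alpha>) (p_cD q a \<alpha> p y) (a / q) = 0"

text \<open>The number \<open>lam\<close> is an eigenvalue iff such a \<open>y\<close> exists.\<close>

definition qfsl_eigenfunction ::
  "real \<Rightarrow> real \<Rightarrow> real \<Rightarrow> (real \<Rightarrow> real) \<Rightarrow> (real \<Rightarrow> real) \<Rightarrow> (real \<Rightarrow> real) \<Rightarrow>
   real \<Rightarrow> real \<Rightarrow> real \<Rightarrow> real \<Rightarrow> complex \<Rightarrow> (real \<Rightarrow> complex) \<Rightarrow> bool" where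
  "qfsl_eigenfunction q a \<alpha> p r w c1 c2 d1 d2 lam y \<longleftrightarrow>
     qfsl_solution q a \<alpha> p r w c1 c2 d1 d2 lam y \<and> (\<exists>x\<in>Aq_star q a. y x \<noteq> 0)"

subsection \<open>Weighted inner product\<close>

definition q_inner ::
  "real \<Rightarrow> real \<Rightarrow> (real \<Rightarrow> real) \<Rightarrow> (real \<Rightarrow> complex) \<Rightarrow> (real \<Rightarrow> complex) \<Rightarrow> complex" where
  "q_inner q a w f g = jackson_integral0 q a (\<lambda>t. f t * cnj (g t) * of_real (w t))"

text \<open>
  Orthogonality includes convergence of the series that defines the inner product. Membership of
  \<open>f\<close> and \<open>g\<close> in the weighted space is not part of the notion.
\<close>

definition q_orthogonal ::
  "real \<Rightarrow> real \<Rightarrow> (real \<Rightarrow> real) \<Rightarrow> (real \<Rightarrow> complex) \<Rightarrow> (real \<Rightarrow> complex) \<Rightarrow> bool" where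
  "q_orthogonal q a w f g \<longleftrightarrow>
     jackson_integrable0 q a (\<lambda>t. f t * cnj (g t) * of_real (w t)) \<and> q_inner q a w f g = 0"

end

theory Submission
  imports Defs
begin

text \<open>
  The proof is the classical one: a Green identity shows that \<open>(\<lambda> - \<mu>) \<langle>u, v\<rangle>\<close> is a difference of
  boundary terms, and the boundary conditions make it vanish. Since the inner product conjugates
  \<open>v\<close>, the eigenvalue that appears is the conjugate of \<open>\<mu>\<close>; the same identity applied to an
  eigenfunction and its own conjugate shows first that eigenvalues are real.

  The work is done on the grid \<open>x\<^sub>n = a q\<^sup>n\<close>. There the left and right fractional integrals are the
  two convolutions with one sequence \<open>K\<close> (\<open>rl_kernel\<close>): with \<open>\<nu> = 1 - \<alpha>\<close> and up to constant
  factors, the Caputo derivative of \<open>y\<close> at \<open>x\<^sub>m\<close> is \<open>x\<^sub>m\<^bsup>\<nu> - 1\<^esup>\<close> times the sum over \<open>j\<close> of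
  \<open>K\<^sub>j (y(x\<^bsub>m+j\<^esub>) - y(x\<^bsub>m+j+1\<^esub>))\<close>, and the right integral at \<open>x\<^sub>n\<close> of a function \<open>f\<close> is the sum
  over \<open>m \<le> n\<close> of \<open>K\<^bsub>n-m\<^esub> b\<^sub>m\<close>, where \<open>b\<^sub>m = x\<^sub>m\<^sup>\<nu> f(x\<^sub>m)\<close>. The equation says that the
  backward differences of the right integral are multiples of \<open>y(x\<^sub>n)\<close>. This turns the boundary value
  problem into a system of difference equations (\<open>sl_system\<close>, reached by
  \<open>qfsl_solution_imp_sl_system\<close>).

  The delicate point is convergence. A solution converges along the grid and the series of the
  right integral at \<open>0\<close> converges, but neither the series of \<open>b\<close> nor that of the differences of
  \<open>y\<close> has to converge absolutely, so the double series behind fractional integration by parts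
  cannot be rearranged freely. The remedy is the estimate \<open>K\<^sub>j = 1 + O(q\<^sup>j)\<close>
  (\<open>rl_kernel_minus_1_bound\<close>): plain summation can be handled by partial sums, and the rest is
  dominated by geometric series. It shows that the right integral is continuous at \<open>0\<close> along the
  grid (\<open>right_conv_tendsto\<close>) and that fractional integration by parts holds in the limit of
  partial sums (\<open>right_conv_by_parts\<close>). The Green identity \<open>sl_system_green\<close> therefore gives both the
  convergence of the series of the inner product and its value \<open>0\<close>.
\<close>

section \<open>The fractional kernel on the grid\<close>
lemma qpoch_inf_has_prod:
  assumes "0 < q" "q < 1"
  shows "(\<lambda>k. 1 - z * q ^ k) has_prod qpoch_inf z q"
proof -
  have "summable (\<lambda>k. norm ((1 - z * q ^ k) - 1))"
    using assms by (simp add: abs_mult power_abs summable_mult summable_geometric)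
  then have "convergent_prod (\<lambda>k. 1 - z * q ^ k)"
    by (intro abs_convergent_prod_imp_convergent_prod summable_imp_abs_convergent_prod)
  then show ?thesis
    unfolding qpoch_inf_def by (rule convergent_prod_has_prod)
qed

lemma qpoch_inf_eq_0:
  assumes "0 < q" "q < 1" "z * q ^ k = 1"
  shows "qpoch_inf z q = 0"
  by (rule has_prod_zeroI[OF qpoch_inf_has_prod[OF assms(1,2)], where n = k]) (simp only: assms(3) diff_self)

lemma mult_power_less_one:
  fixes q z :: real
  assumes "0 < q" "q < 1" "0 \<le> z" "z < 1"
  shows "z * q ^ n < 1"
proof -
  have "z * q ^ n \<le> z * 1"
    using assms by (intro mult_left_mono power_le_one) simp_all
  then show ?thesis
    using assms by linarith
qed

lemma qpoch_inf_pos: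
  assumes "0 < q" "q < 1" "0 \<le> z" "z < 1"
  shows "0 < qpoch_inf z q"
proof (rule has_prod_pos[OF qpoch_inf_has_prod[OF assms(1,2)]])
  show "0 < 1 - z * q ^ n" for n
    using mult_power_less_one[OF assms, of n] by simp
qed

lemma qpoch_inf_split:
  assumes "0 < q" "q < 1"
  shows "qpoch_inf z q = (\<Prod>k<n. 1 - z * q ^ k) * qpoch_inf (z * q ^ n) q"
proof -
  have cp: "convergent_prod (\<lambda>k. 1 - z * q ^ k)"
    using qpoch_inf_has_prod[OF assms] by (auto simp: has_prod_iff)
  have "qpoch_inf (z * q ^ n) q = (\<Prod>k. 1 - z * q ^ (k + n))"
    unfolding qpoch_inf_def by (simp add: power_add mult_ac)
  then show ?thesis
    using has_prod_unique2[OF qpoch_inf_has_prod[OF assms] has_prod_ignore_initial_segment'[OF cp, of n]]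
    by simp
qed

text \<open>
  The infinite product over the factors from index \<open>n\<close> on is the quotient of the whole product by
  a partial product. The quotient tends to \<open>1\<close> because the whole product is nonzero.
\<close>

lemma qpoch_inf_tendsto_1:
  assumes "0 < q" "q < 1" "0 \<le> z" "z < 1"
  shows "(\<lambda>n. qpoch_inf (z * q ^ n) q) \<longlonglongrightarrow> 1"
proof -
  let ?P = "\<lambda>n. \<Prod>k<n. 1 - z * q ^ k"
  have nz: "qpoch_inf z q \<noteq> 0"
    using qpoch_inf_pos[OF assms] by simp
  have "?P \<longlonglongrightarrow> qpoch_inf z q"
    by (rule has_prod_imp_tendsto'[OF qpoch_inf_has_prod[OF assms(1,2)]])
  then have "(\<lambda>n. qpoch_inf z q / ?P n) \<longlonglongrightarrow> qpoch_inf z q / qpoch_inf z q"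
    using nz by (intro tendsto_intros)
  moreover have "qpoch_inf z q / ?P n = qpoch_inf (z * q ^ n) q" for n
    using qpoch_inf_split[OF assms(1,2), of z n] nz by (auto simp: field_simps)
  ultimately show ?thesis
    using nz by simp
qed

text \<open>
  On the grid \<open>a q\<^sup>n\<close> both fractional integrals of order \<open>\<nu>\<close> see their kernel only through the
  difference of the two grid indices, so they become convolutions with this one sequence: upwards
  for the left integral, downwards for the right one.
\<close>

definition rl_kernel :: "real \<Rightarrow> real \<Rightarrow> nat \<Rightarrow> real" where
  "rl_kernel q \<nu> j = qpoch (q ^ Suc j) q (\<nu> - 1)"

lemma rl_kernel_altdef:
  assumes "0 < q"
  shows "rl_kernel q \<nu> j = qpoch_inf (q * q ^ j) q / qpoch_inf (q powr \<nu> * q ^ j) q"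
proof -
  have "q ^ Suc j * q powr (\<nu> - 1) = q powr \<nu> * q ^ j"
    using powr_mult_base[of q "\<nu> - 1"] assms by (simp add: mult_ac)
  then show ?thesis
    by (simp only: rl_kernel_def qpoch_def power_Suc)
qed

lemma rl_kernel_tendsto_1:
  assumes "0 < q" "q < 1" "0 < \<nu>"
  shows "rl_kernel q \<nu> \<longlonglongrightarrow> 1"
proof -
  have "q powr \<nu> < 1"
    using assms by (simp add: powr01_less_one)
  then have "(\<lambda>j. qpoch_inf (q * q ^ j) q / qpoch_inf (q powr \<nu> * q ^ j) q) \<longlonglongrightarrow> 1 / 1"
    using assms by (intro tendsto_divide qpoch_inf_tendsto_1) auto
  then show ?thesis
    using assms by (simp add: rl_kernel_altdef[OF assms(1), abs_def])
qed

lemma rl_kernel_Suc: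
  assumes "0 < q" "q < 1" "0 < \<nu>"
  shows "rl_kernel q \<nu> j * (1 - q powr \<nu> * q ^ j) = rl_kernel q \<nu> (Suc j) * (1 - q * q ^ j)"
proof -
  have qn: "q powr \<nu> < 1"
    using assms by (simp add: powr01_less_one)
  have step: "qpoch_inf (z * q ^ j) q = (1 - z * q ^ j) * qpoch_inf (z * q ^ Suc j) q" for z
    using qpoch_inf_split[OF assms(1,2), of "z * q ^ j" 1] by (simp add: mult_ac)
  have "0 < qpoch_inf (q powr \<nu> * q ^ i) q" for i
    using assms qn by (intro qpoch_inf_pos mult_power_less_one) auto
  from this[of j] this[of "Suc j"] mult_power_less_one[of q "q powr \<nu>" j] mult_power_less_one[of q q j] qn assms show ?thesis
    unfolding rl_kernel_altdef[OF assms(1)] step[of q] step[of "q powr \<nu>"]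
    by (auto simp: field_simps)
qed

text \<open>
  Consecutive values differ by \<open>O(q\<^sup>j)\<close> because their ratio is
  \<open>(1 - q\<^sup>j q\<^sup>\<nu>) / (1 - q\<^sup>j q)\<close>. Summing the differences up to the limit \<open>1\<close> gives the bound. It
  says that convolution with the kernel is plain summation plus convolution with a geometrically
  decaying sequence, which is all that the limit arguments below use of the kernel.
\<close>

lemma rl_kernel_minus_1_bound:
  assumes "0 < q" "q < 1" "0 < \<nu>"
  obtains M where "\<And>j. \<bar>rl_kernel q \<nu> j - 1\<bar> \<le> M * q ^ j"
proof -
  let ?K = "rl_kernel q \<nu>"
  have lim: "?K \<longlonglongrightarrow> 1"
    by (rule rl_kernel_tendsto_1[OF assms])
  then have "Bseq ?K"
    by (intro convergent_imp_Bseq convergentI)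
  then obtain B where B: "0 < B" "\<And>j. \<bar>?K j\<bar> \<le> B"
    by (auto elim: BseqE)
  have qn: "q powr \<nu> < 1"
    using assms by (simp add: powr01_less_one)
  define M where "M = B / (1 - q)"
  have M: "0 \<le> M" using B assms by (simp add: M_def)
  have step: "\<bar>?K (Suc j) - ?K j\<bar> \<le> M * q ^ j" for j
  proof -
    have q1: "q * q ^ j \<le> q" "q * q ^ j < 1"
      using assms mult_power_less_one[of q q j] by (simp_all add: mult_left_le power_le_one)
    have "(?K (Suc j) - ?K j) * (1 - q * q ^ j) = ?K j * (q - q powr \<nu>) * q ^ j"
      using rl_kernel_Suc[OF assms, of j] by (simp add: algebra_simps)
    then have "?K (Suc j) - ?K j = ?K j * (q - q powr \<nu>) * q ^ j / (1 - q * q ^ j)"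
      using q1 by (simp add: eq_divide_eq)
    then have "\<bar>?K (Suc j) - ?K j\<bar> = \<bar>?K j\<bar> * \<bar>q - q powr \<nu>\<bar> * q ^ j / (1 - q * q ^ j)"
      using q1 assms by (simp add: abs_mult)
    also have "\<dots> \<le> B * 1 * q ^ j / (1 - q)"
    proof (rule frac_le)
      have "\<bar>q - q powr \<nu>\<bar> \<le> 1"
        using assms qn powr_ge_zero[of q \<nu>] by linarith
      then show "\<bar>?K j\<bar> * \<bar>q - q powr \<nu>\<bar> * q ^ j \<le> B * 1 * q ^ j"
        using B assms by (intro mult_mono mult_nonneg_nonneg) auto
    qed (use q1 assms B in auto)
    finally show ?thesis by (simp add: M_def)
  qed
  have dist: "\<bar>?K (j + n) - ?K j\<bar> \<le> M / (1 - q) * q ^ j" for j n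
  proof -
    have "?K (j + n) - ?K j = (\<Sum>i<n. ?K (Suc (j + i)) - ?K (j + i))"
      by (induction n) auto
    also have "\<bar>\<dots>\<bar> \<le> (\<Sum>i<n. \<bar>?K (Suc (j + i)) - ?K (j + i)\<bar>)"
      by (rule sum_abs)
    also have "\<dots> \<le> (\<Sum>i<n. M * q ^ j * q ^ i)"
      using step[of "j + i" for i] by (intro sum_mono) (simp add: power_add mult.assoc)
    also have "\<dots> = M * q ^ j * (\<Sum>i<n. q ^ i)"
      by (simp add: sum_distrib_left)
    also have "\<dots> \<le> M * q ^ j * (1 / (1 - q))"
    proof (rule mult_left_mono)
      have "(\<Sum>i<n. q ^ i) = (1 - q ^ n) / (1 - q)"
        using assms by (simp add: sum_gp_strict)
      then show "(\<Sum>i<n. q ^ i) \<le> 1 / (1 - q)"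
        using assms by (simp add: divide_right_mono)
    qed (use M assms in auto)
    finally show ?thesis by simp
  qed
  show thesis
  proof (rule that)
    fix j
    have "(\<lambda>n. \<bar>?K (j + n) - ?K j\<bar>) \<longlonglongrightarrow> \<bar>1 - ?K j\<bar>"
      using LIMSEQ_ignore_initial_segment[OF lim, of j]
      by (intro tendsto_intros) (simp add: add.commute)
    then have "\<bar>1 - ?K j\<bar> \<le> M / (1 - q) * q ^ j"
      by (rule LIMSEQ_le_const2) (use dist in auto)
    then show "\<bar>?K j - 1\<bar> \<le> M / (1 - q) * q ^ j" by (simp add: abs_minus_commute)
  qed
qed

section \<open>Discrete fractional sums\<close>
lemma suminf_tendsto_dominated:
  fixes a :: "nat \<Rightarrow> nat \<Rightarrow> 'a :: {real_normed_algebra, banach}"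
  assumes "\<And>k. (\<lambda>n. a k n) \<longlonglongrightarrow> b k" "\<And>k n. norm (a k n) \<le> M k" "summable M"
  shows "(\<lambda>n. \<Sum>k. a k n) \<longlonglongrightarrow> suminf b"
  using tannerys_theorem[of a b sequentially M] assms by (simp add: always_eventually case_prod_unfold)

text \<open>
  Dominated convergence for sums whose length grows with the parameter: cutting the terms off at
  \<open>N\<close> turns them into full series.
\<close>

lemma finite_sums_tendsto_0_geometric:
  fixes T :: "nat \<Rightarrow> nat \<Rightarrow> complex"
  assumes q: "0 < q" "q < 1"
    and bound: "\<And>i N. norm (T i N) \<le> M * q ^ i"
    and lim: "\<And>i. T i \<longlonglongrightarrow> 0"
  shows "(\<lambda>N. \<Sum>i\<le>N. T i N) \<longlonglongrightarrow> 0"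
proof -
  have M: "0 \<le> M"
    using order_trans[OF norm_ge_zero bound[of 0 0]] by simp
  define T' where "T' i N = (if i \<le> N then T i N else 0)" for i N
  have "(\<lambda>N. \<Sum>i. T' i N) \<longlonglongrightarrow> (\<Sum>i. 0)"
  proof (rule suminf_tendsto_dominated)
    show "T' i \<longlonglongrightarrow> 0" for i
      by (rule Lim_transform_eventually[OF lim[of i]])
         (auto simp: T'_def eventually_at_top_linorder intro!: exI[of _ i])
    show "norm (T' i N) \<le> M * q ^ i" for i N
      using bound[of i N] M q by (auto simp: T'_def)
    show "summable (\<lambda>i. M * q ^ i)"
      using q by (intro summable_mult summable_geometric) auto
  qed
  moreover have "(\<Sum>i. T' i N) = (\<Sum>i\<le>N. T i N)" for N
    by (subst suminf_finite[of "{..N}"]) (auto simp: T'_def)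
  ultimately show ?thesis by simp
qed

definition right_conv :: "(nat \<Rightarrow> complex) \<Rightarrow> (nat \<Rightarrow> complex) \<Rightarrow> nat \<Rightarrow> complex" where
  "right_conv K b n = (\<Sum>m\<le>n. K (n - m) * b m)"

definition left_conv :: "(nat \<Rightarrow> complex) \<Rightarrow> (nat \<Rightarrow> complex) \<Rightarrow> nat \<Rightarrow> complex" where
  "left_conv K g m = (\<Sum>j. K j * g (m + j))"

lemma sum_atMost_reverse: "(\<Sum>m\<le>n. f m (n - m)) = (\<Sum>i\<le>(n::nat). f (n - i) i)"
  for f :: "nat \<Rightarrow> nat \<Rightarrow> complex"
  by (rule sum.reindex_bij_witness[of _ "\<lambda>i. n - i" "\<lambda>i. n - i"]) auto

text \<open>
  Writing the kernel as \<open>1 + (K - 1)\<close>, the first part gives the partial sums of \<open>b\<close>, and the second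
  is the convolution of an absolutely summable sequence with a null sequence. Convergence of the
  series of \<open>b\<close> may be conditional.
\<close>

lemma right_conv_tendsto:
  assumes q: "0 < q" "q < 1"
    and K: "\<And>j. norm (K j - 1) \<le> M * q ^ j"
    and b: "summable b"
  shows "right_conv K b \<longlonglongrightarrow> suminf b"
proof -
  have b0: "b \<longlonglongrightarrow> 0"
    by (rule summable_LIMSEQ_zero[OF b])
  then obtain B where B: "0 < B" "\<And>n. norm (b n) \<le> B"
    using b by (meson BseqE convergentI convergent_imp_Bseq)
  have M: "0 \<le> M"
    using order_trans[OF norm_ge_zero K[of 0]] by simp
  have "(\<lambda>n. \<Sum>i\<le>n. (K i - 1) * b (n - i)) \<longlonglongrightarrow> 0"
  proof (rule finite_sums_tendsto_0_geometric[OF q])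
    fix i n
    have "norm ((K i - 1) * b (n - i)) \<le> (M * q ^ i) * B"
      unfolding norm_mult using B K M q by (intro mult_mono) auto
    then show "norm ((K i - 1) * b (n - i)) \<le> (M * B) * q ^ i"
      by (simp add: mult_ac)
  next
    fix i
    have "(\<lambda>n. (K i - 1) * b (n - i)) \<longlonglongrightarrow> (K i - 1) * 0"
      by (intro tendsto_mult tendsto_const seq_offset_neg b0)
    then show "(\<lambda>n. (K i - 1) * b (n - i)) \<longlonglongrightarrow> 0" by simp
  qed
  moreover have "(\<lambda>n. \<Sum>m\<le>n. b m) \<longlonglongrightarrow> suminf b"
    using b by (rule summable_LIMSEQ')
  ultimately have "(\<lambda>n. (\<Sum>i\<le>n. (K i - 1) * b (n - i)) + (\<Sum>m\<le>n. b m)) \<longlonglongrightarrow> 0 + suminf b"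
    by (rule tendsto_add)
  moreover have "(\<Sum>i\<le>n. (K i - 1) * b (n - i)) + (\<Sum>m\<le>n. b m) = right_conv K b n" for n
    unfolding right_conv_def sum_atMost_reverse[of "\<lambda>m i. (K i - 1) * b m" n, symmetric]
    by (simp add: sum.distrib[symmetric] algebra_simps)
  ultimately show ?thesis by simp
qed

lemma summable_kernel_mult:
  assumes q: "0 < q" "q < 1"
    and K: "\<And>j. norm (K j - 1) \<le> M * q ^ j"
    and g: "summable (g :: nat \<Rightarrow> complex)"
  shows "summable (\<lambda>j. (K (j + i) - 1) * g (j + m))" and "summable (\<lambda>j. K (j + i) * g (j + m))"
proof -
  obtain B where B: "0 < B" "\<And>n. norm (g n) \<le> B"
    using summable_LIMSEQ_zero[OF g] by (meson BseqE convergentI convergent_imp_Bseq)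
  have M: "0 \<le> M"
    using order_trans[OF norm_ge_zero K[of 0]] by simp
  show 1: "summable (\<lambda>j. (K (j + i) - 1) * g (j + m))"
  proof (rule summable_comparison_test'[of "\<lambda>j. (M * q ^ i * B) * q ^ j" 0])
    show "summable (\<lambda>j. (M * q ^ i * B) * q ^ j)"
      using q by (intro summable_mult summable_geometric) auto
    fix j
    have "norm ((K (j + i) - 1) * g (j + m)) \<le> (M * q ^ (j + i)) * B"
      unfolding norm_mult using B K M q by (intro mult_mono) auto
    then show "norm ((K (j + i) - 1) * g (j + m)) \<le> (M * q ^ i * B) * q ^ j"
      by (simp add: power_add mult_ac)
  qed
  have "summable (\<lambda>j. (K (j + i) - 1) * g (j + m) + g (j + m))"
    using g by (intro summable_add 1) (simp add: summable_iff_shift)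
  then show "summable (\<lambda>j. K (j + i) * g (j + m))"
    by (simp add: algebra_simps)
qed

text \<open>
  The discrete form of fractional integration by parts. Exchanging the two finite summations turns
  the first sum into the second one, except that each inner series is cut off at \<open>N\<close>. As \<open>b\<close> and
  \<open>g\<close> need not be absolutely summable, the exchange cannot be made in the infinite double series,
  and the tails that are cut off have to be shown to vanish together. With \<open>K = 1 + (K - 1)\<close> they
  split into a partial sum of \<open>b\<close> times a tail of the series of \<open>g\<close>, and a rest that is
  dominated by a geometric series in the distance from \<open>N\<close>.
\<close>

lemma right_conv_by_parts:
  assumes q: "0 < q" "q < 1"
    and K: "\<And>j. norm (K j - 1) \<le> M * q ^ j"
    and b: "summable b" and g: "summable g"
  shows "(\<lambda>N. (\<Sum>n\<le>N. right_conv K b n * g n) - (\<Sum>m\<le>N. b m * left_conv K g m)) \<longlonglongrightarrow> 0"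
proof -
  obtain B where B: "0 < B" "\<And>n. norm (b n) \<le> B"
    using summable_LIMSEQ_zero[OF b] by (meson BseqE convergentI convergent_imp_Bseq)
  obtain C where C: "0 < C" "\<And>n. norm (g n) \<le> C"
    using summable_LIMSEQ_zero[OF g] by (meson BseqE convergentI convergent_imp_Bseq)
  have M: "0 \<le> M"
    using order_trans[OF norm_ge_zero K[of 0]] by simp
  note sm = summable_kernel_mult[OF q K g]
  \<comment> \<open>The inner tail at \<open>m = N - i\<close>, with the kernel replaced by its deviation from \<open>1\<close>.\<close>
  define S where "S i N = (\<Sum>j. (K (j + Suc i) - 1) * g (j + Suc N))" for i N
  have err: "(\<Sum>n\<le>N. right_conv K b n * g n) - (\<Sum>m\<le>N. b m * left_conv K g m)
      = - (\<Sum>i\<le>N. b (N - i) * S i N) - (\<Sum>m\<le>N. b m) * (\<Sum>j. g (j + Suc N))" for N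
  proof -
    have "(\<Sum>n\<le>N. right_conv K b n * g n)
        = (\<Sum>n\<le>N. \<Sum>m\<le>n. K (n - m) * b m * g (m + (n - m)))"
      by (simp add: right_conv_def sum_distrib_right)
    also have "\<dots> = (\<Sum>(m, j)\<in>{(m, j). m + j \<le> N}. K j * b m * g (m + j))"
      by (rule sum.triangle_reindex_eq[symmetric])
    also have "{(m, j). m + j \<le> N} = Sigma {..N} (\<lambda>m. {..<Suc (N - m)})"
      by auto
    also have "(\<Sum>(m, j)\<in>\<dots>. K j * b m * g (m + j))
        = (\<Sum>m\<le>N. b m * (\<Sum>j<Suc (N - m). K j * g (m + j)))"
      by (subst sum.Sigma[symmetric]) (auto simp: sum_distrib_left mult_ac simp del: sum.lessThan_Suc)
    finally have fin: "(\<Sum>n\<le>N. right_conv K b n * g n)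
        = (\<Sum>m\<le>N. b m * (\<Sum>j<Suc (N - m). K j * g (m + j)))" .
    have split: "left_conv K g m
        = (\<Sum>j<Suc (N - m). K j * g (m + j)) + (S (N - m) N + (\<Sum>j. g (j + Suc N)))"
      if "m \<le> N" for m
    proof -
      have "left_conv K g m = (\<Sum>j. K (j + Suc (N - m)) * g (m + (j + Suc (N - m))))
          + (\<Sum>j<Suc (N - m). K j * g (m + j))"
        unfolding left_conv_def
        using sm(2)[of 0 m] by (intro suminf_split_initial_segment) (simp add: add.commute)
      also have "(\<Sum>j. K (j + Suc (N - m)) * g (m + (j + Suc (N - m))))
          = (\<Sum>j. (K (j + Suc (N - m)) - 1) * g (j + Suc N) + g (j + Suc N))"
        using that by (intro suminf_cong) (simp add: algebra_simps)
      also have "\<dots> = S (N - m) N + (\<Sum>j. g (j + Suc N))"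
        unfolding S_def using sm(1) summable_ignore_initial_segment[OF g]
        by (rule suminf_add[symmetric])
      finally show ?thesis by simp
    qed
    have "(\<Sum>m\<le>N. b m * left_conv K g m) = (\<Sum>m\<le>N. b m * (\<Sum>j<Suc (N - m). K j * g (m + j)))
        + (\<Sum>m\<le>N. b m * S (N - m) N) + (\<Sum>m\<le>N. b m) * (\<Sum>j. g (j + Suc N))"
      unfolding sum_distrib_right sum.distrib[symmetric]
      by (intro sum.cong refl) (simp add: split algebra_simps del: sum.lessThan_Suc)
    also have "(\<Sum>m\<le>N. b m * S (N - m) N) = (\<Sum>i\<le>N. b (N - i) * S i N)"
      by (rule sum_atMost_reverse)
    finally show ?thesis
      unfolding fin by simp
  qed
  have "(\<lambda>N. \<Sum>i\<le>N. b (N - i) * S i N) \<longlonglongrightarrow> 0"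
  proof (rule finite_sums_tendsto_0_geometric[OF q])
    fix i N
    have term_bound: "norm ((K (j + Suc i) - 1) * g (j + Suc N)) \<le> (M * q ^ Suc i * C) * q ^ j" for i j N
    proof -
      have "norm ((K (j + Suc i) - 1) * g (j + Suc N)) \<le> (M * q ^ (j + Suc i)) * C"
        unfolding norm_mult by (rule mult_mono[OF K C(2)]) (use M q in auto)
      then show ?thesis by (simp add: power_add mult_ac)
    qed
    have geo: "summable (\<lambda>j. (M * q ^ Suc i * C) * q ^ j)" for i
      using q by (intro summable_mult summable_geometric) auto
    have "norm (S i N) \<le> (\<Sum>j. (M * q ^ Suc i * C) * q ^ j)"
      unfolding S_def by (rule norm_suminf_le[OF term_bound geo])
    also have "\<dots> = (M * q ^ Suc i * C) * (1 / (1 - q))"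
      using q by (subst suminf_mult) (auto simp: suminf_geometric summable_geometric)
    finally have "norm (b (N - i) * S i N) \<le> B * ((M * q ^ Suc i * C) * (1 / (1 - q)))"
      unfolding norm_mult using B C M q by (intro mult_mono) auto
    then show "norm (b (N - i) * S i N) \<le> (B * M * q * C / (1 - q)) * q ^ i"
      by (simp add: mult_ac)
    have "(\<lambda>N. S i N) \<longlonglongrightarrow> (\<Sum>j. 0)"
      unfolding S_def
    proof (rule suminf_tendsto_dominated[OF _ term_bound geo])
      fix j
      have "(\<lambda>N. g (j + Suc N)) \<longlonglongrightarrow> 0"
        using LIMSEQ_ignore_initial_segment[OF summable_LIMSEQ_zero[OF g], of "Suc j"]
        by (simp add: add.commute)
      then have "(\<lambda>N. (K (j + Suc i) - 1) * g (j + Suc N)) \<longlonglongrightarrow> (K (j + Suc i) - 1) * 0"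
        by (intro tendsto_mult tendsto_const)
      then show "(\<lambda>N. (K (j + Suc i) - 1) * g (j + Suc N)) \<longlonglongrightarrow> 0" by simp
    qed
    then have "(\<lambda>N. b (N - i) * S i N) \<longlonglongrightarrow> 0 * 0"
      by (intro tendsto_mult seq_offset_neg summable_LIMSEQ_zero[OF b]) simp
    then show "(\<lambda>N. b (N - i) * S i N) \<longlonglongrightarrow> 0" by simp
  qed
  moreover have "(\<lambda>N. (\<Sum>m\<le>N. b m) * (\<Sum>j. g (j + Suc N))) \<longlonglongrightarrow> suminf b * 0"
  proof (rule tendsto_mult[OF summable_LIMSEQ'[OF b]])
    have "(\<lambda>N. suminf g - (\<Sum>j<N. g j)) \<longlonglongrightarrow> suminf g - suminf g"
      by (intro tendsto_intros summable_LIMSEQ g)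
    then have "(\<lambda>N. \<Sum>j. g (j + N)) \<longlonglongrightarrow> 0"
      by (simp add: suminf_minus_initial_segment[OF g])
    then show "(\<lambda>N. \<Sum>j. g (j + Suc N)) \<longlonglongrightarrow> 0"
      by (rule LIMSEQ_Suc)
  qed
  ultimately have "(\<lambda>N. - (\<Sum>i\<le>N. b (N - i) * S i N) - (\<Sum>m\<le>N. b m) * (\<Sum>j. g (j + Suc N)))
      \<longlonglongrightarrow> - 0 - suminf b * 0"
    by (intro tendsto_diff tendsto_minus)
  then show ?thesis
    unfolding err by simp
qed

section \<open>The discrete Sturm--Liouville system\<close>
text \<open>
  The boundary value problem in grid coordinates: \<open>Y n\<close> is the value of the solution at \<open>a q\<^sup>n\<close> and
  \<open>L\<close> its value at \<open>0\<close>; \<open>K\<close> is the fractional kernel; \<open>\<beta>\<close>, \<open>\<rho>\<close> and \<open>\<omega>\<close> carry the coefficients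
  \<open>p\<close>, \<open>r\<close> and \<open>w\<close> together with the powers of the grid points; \<open>b m\<close> is the \<open>m\<close>-th term of the
  series for the right fractional integral of \<open>p\<close> times the Caputo derivative at \<open>0\<close>. The value
  \<open>0\<close> of the preceding term at \<open>n = 0\<close> is the right integral at \<open>a / q\<close>, which runs from \<open>a\<close> to
  \<open>a\<close>. The last equation is the boundary condition at \<open>0\<close>.
\<close>

definition sl_system where
  "sl_system K \<beta> \<rho> \<omega> \<gamma>1 \<gamma>2 lam Y L b \<longleftrightarrow>
     Y \<longlonglongrightarrow> L \<and> summable b \<and>
     (\<forall>m. b m = of_real (\<beta> m) * left_conv (\<lambda>j. of_real (K j)) (\<lambda>n. Y n - Y (Suc n)) m) \<and>
     (\<forall>n. right_conv (\<lambda>j. of_real (K j)) b n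
          - (case n of 0 \<Rightarrow> 0 | Suc k \<Rightarrow> right_conv (\<lambda>j. of_real (K j)) b k)
        = (lam * of_real (\<omega> n) - of_real (\<rho> n)) * Y n) \<and>
     of_real \<gamma>1 * L + of_real \<gamma>2 * suminf b = 0"
  for K \<beta> \<rho> \<omega> :: "nat \<Rightarrow> real" and \<gamma>1 \<gamma>2 :: real and lam L :: complex and Y b :: "nat \<Rightarrow> complex"

lemma summation_by_parts:
  "(\<Sum>n\<le>N. (R n - (case n of 0 \<Rightarrow> 0 | Suc k \<Rightarrow> R k)) * V n)
     = R N * V (Suc N) + (\<Sum>n\<le>N. R n * (V n - V (Suc n)))" for R V :: "nat \<Rightarrow> complex"
  by (induction N) (auto simp: algebra_simps)

text \<open>
  All coefficients are real. Conjugating a solution once and for all means that the Green identity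
  below can be stated for two solutions without any conjugates.
\<close>

lemma sl_system_cnj:
  assumes "0 < q" "q < 1" "\<And>j. \<bar>K j - 1\<bar> \<le> M * q ^ j"
    and "sl_system K \<beta> \<rho> \<omega> \<gamma>1 \<gamma>2 lam Y L b"
  shows "sl_system K \<beta> \<rho> \<omega> \<gamma>1 \<gamma>2 (cnj lam) (\<lambda>n. cnj (Y n)) (cnj L) (\<lambda>n. cnj (b n))"
proof -
  let ?K = "\<lambda>j. complex_of_real (K j)"
  note sol = assms(4)[unfolded sl_system_def]
  have Y: "Y \<longlonglongrightarrow> L" and b: "summable b"
    using sol by auto
  have K: "norm (?K j - 1) \<le> M * q ^ j" for j
    using assms(3)[of j] by (metis norm_of_real of_real_1 of_real_diff real_norm_def)
  have g: "summable (\<lambda>n. Y n - Y (Suc n))"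
    using telescope_summable'[OF Y] .
  have sm: "summable (\<lambda>j. ?K j * (Y (m + j) - Y (Suc (m + j))))" for m
    using summable_kernel_mult(2)[OF assms(1,2) K g, of 0 m] by (simp add: add.commute)
  have l: "left_conv ?K (\<lambda>n. cnj (Y n) - cnj (Y (Suc n))) m
      = cnj (left_conv ?K (\<lambda>n. Y n - Y (Suc n)) m)" for m
  proof -
    have "(\<lambda>j. cnj (?K j * (Y (m + j) - Y (Suc (m + j))))) sums cnj (\<Sum>j. ?K j * (Y (m + j) - Y (Suc (m + j))))"
      unfolding sums_cnj using sm by (rule summable_sums)
    then show ?thesis
      by (simp add: left_conv_def sums_iff)
  qed
  have r: "right_conv ?K (\<lambda>n. cnj (b n)) n = cnj (right_conv ?K b n)" for n
    by (simp add: right_conv_def)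
  have sb: "(\<lambda>n. cnj (b n)) sums cnj (suminf b)"
    unfolding sums_cnj using b by (rule summable_sums)
  have "(\<forall>n. cnj (right_conv ?K b n) - (case n of 0 \<Rightarrow> 0 | Suc k \<Rightarrow> cnj (right_conv ?K b k))
        = (cnj lam * of_real (\<omega> n) - of_real (\<rho> n)) * cnj (Y n))"
  proof
    fix n
    have "cnj (right_conv ?K b n - (case n of 0 \<Rightarrow> 0 | Suc k \<Rightarrow> right_conv ?K b k))
        = cnj ((lam * of_real (\<omega> n) - of_real (\<rho> n)) * Y n)"
      using sol by metis
    then show "cnj (right_conv ?K b n) - (case n of 0 \<Rightarrow> 0 | Suc k \<Rightarrow> cnj (right_conv ?K b k))
        = (cnj lam * of_real (\<omega> n) - of_real (\<rho> n)) * cnj (Y n)"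
      by (simp split: nat.splits)
  qed
  moreover have "of_real \<gamma>1 * cnj L + of_real \<gamma>2 * cnj (suminf b) = 0"
  proof -
    have "cnj (of_real \<gamma>1 * L + of_real \<gamma>2 * suminf b) = 0"
      using sol by simp
    then show ?thesis by simp
  qed
  moreover have "(\<lambda>n. cnj (Y n)) \<longlonglongrightarrow> cnj L"
    using Y by (rule tendsto_cnj)
  moreover have "cnj (b m) = of_real (\<beta> m) * cnj (left_conv ?K (\<lambda>n. Y n - Y (Suc n)) m)" for m
    using sol by (metis complex_cnj_mult complex_cnj_complex_of_real)
  ultimately show ?thesis
    using sb unfolding sl_system_def l r by (auto simp: sums_iff)
qed

text \<open>
  Summation by parts moves the difference in the recurrence from the right convolution of \<open>b\<close> to
  \<open>V\<close>, and \<open>right_conv_by_parts\<close> then moves the convolution as well. What remains in the limit is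
  the boundary term at \<open>0\<close>.
\<close>

lemma sl_system_half_green:
  assumes "0 < q" "q < 1" "\<And>j. \<bar>K j - 1\<bar> \<le> M * q ^ j"
    and sol: "sl_system K \<beta> \<rho> \<omega> \<gamma>1 \<gamma>2 lam U A b" and V: "V \<longlonglongrightarrow> C"
  shows "(\<lambda>N. (\<Sum>n\<le>N. (lam * of_real (\<omega> n) - of_real (\<rho> n)) * U n * V n)
      - (\<Sum>m\<le>N. b m * left_conv (\<lambda>j. of_real (K j)) (\<lambda>n. V n - V (Suc n)) m)) \<longlonglongrightarrow> suminf b * C"
proof -
  let ?K = "\<lambda>j. complex_of_real (K j)"
  have b: "summable b"
    and rec: "\<And>n. right_conv ?K b n - (case n of 0 \<Rightarrow> 0 | Suc k \<Rightarrow> right_conv ?K b k)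
        = (lam * of_real (\<omega> n) - of_real (\<rho> n)) * U n"
    using sol by (auto simp: sl_system_def)
  have K: "norm (?K j - 1) \<le> M * q ^ j" for j
    using assms(3)[of j] by (metis norm_of_real of_real_1 of_real_diff real_norm_def)
  have "(\<lambda>N. right_conv ?K b N * V (Suc N) + ((\<Sum>n\<le>N. right_conv ?K b n * (V n - V (Suc n)))
        - (\<Sum>m\<le>N. b m * left_conv ?K (\<lambda>n. V n - V (Suc n)) m))) \<longlonglongrightarrow> suminf b * C + 0"
    by (intro tendsto_add tendsto_mult right_conv_tendsto[OF assms(1,2) K b] LIMSEQ_Suc V
        right_conv_by_parts[OF assms(1,2) K b telescope_summable'[OF V]])
  moreover have "(\<Sum>n\<le>N. (lam * of_real (\<omega> n) - of_real (\<rho> n)) * U n * V n)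
      = right_conv ?K b N * V (Suc N) + (\<Sum>n\<le>N. right_conv ?K b n * (V n - V (Suc n)))" for N
    unfolding rec[symmetric] by (rule summation_by_parts)
  ultimately show ?thesis
    by (simp add: add_diff_eq)
qed

text \<open>
  After subtracting the half Green identity with the roles exchanged, the sums with \<open>b\<close> and \<open>c\<close> cancel,
  because both are the same symmetric bilinear expression with weights \<open>\<beta>\<close>. The boundary terms cancel because
  the two boundary conditions at \<open>0\<close> are one homogeneous linear system with a nontrivial solution
  \<open>(\<gamma>1, \<gamma>2)\<close>, so its determinant vanishes.
\<close>

lemma sl_system_green:
  assumes "0 < q" "q < 1" "\<And>j. \<bar>K j - 1\<bar> \<le> M * q ^ j"
    and u: "sl_system K \<beta> \<rho> \<omega> \<gamma>1 \<gamma>2 lam U A b"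
    and v: "sl_system K \<beta> \<rho> \<omega> \<gamma>1 \<gamma>2 mu V C c"
    and \<gamma>: "\<gamma>1 \<noteq> 0 \<or> \<gamma>2 \<noteq> 0" and ne: "lam \<noteq> mu"
  shows "(\<lambda>n. of_real (\<omega> n) * U n * V n) sums 0"
proof -
  let ?K = "\<lambda>j. complex_of_real (K j)"
  have bd: "of_real \<gamma>1 * A + of_real \<gamma>2 * suminf b = 0" "of_real \<gamma>1 * C + of_real \<gamma>2 * suminf c = 0"
    and lims: "U \<longlonglongrightarrow> A" "V \<longlonglongrightarrow> C"
    and bc: "\<And>m. b m = of_real (\<beta> m) * left_conv ?K (\<lambda>n. U n - U (Suc n)) m"
      "\<And>m. c m = of_real (\<beta> m) * left_conv ?K (\<lambda>n. V n - V (Suc n)) m"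
    using u v by (auto simp: sl_system_def)
  have "of_real \<gamma>1 * (suminf b * C - suminf c * A) = 0"
    using bd by algebra
  moreover have "of_real \<gamma>2 * (suminf b * C - suminf c * A) = 0"
    using bd by algebra
  ultimately have wr: "suminf b * C - suminf c * A = 0"
    using \<gamma> by auto
  have "(\<lambda>N. (\<Sum>n\<le>N. (lam - mu) * (of_real (\<omega> n) * U n * V n))) \<longlonglongrightarrow> 0"
  proof (rule Lim_transform_eventually[OF _ always_eventually])
    show "(\<lambda>N. ((\<Sum>n\<le>N. (lam * of_real (\<omega> n) - of_real (\<rho> n)) * U n * V n)
          - (\<Sum>m\<le>N. b m * left_conv ?K (\<lambda>n. V n - V (Suc n)) m))
        - ((\<Sum>n\<le>N. (mu * of_real (\<omega> n) - of_real (\<rho> n)) * V n * U n)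
          - (\<Sum>m\<le>N. c m * left_conv ?K (\<lambda>n. U n - U (Suc n)) m))) \<longlonglongrightarrow> 0"
      using tendsto_diff[OF sl_system_half_green[OF assms(1-3) u lims(2)]
          sl_system_half_green[OF assms(1-3) v lims(1)]] wr by simp
    have "b m * left_conv ?K (\<lambda>n. V n - V (Suc n)) m = c m * left_conv ?K (\<lambda>n. U n - U (Suc n)) m" for m
      unfolding bc by (simp add: mult_ac)
    then show "\<forall>N. ((\<Sum>n\<le>N. (lam * of_real (\<omega> n) - of_real (\<rho> n)) * U n * V n)
          - (\<Sum>m\<le>N. b m * left_conv ?K (\<lambda>n. V n - V (Suc n)) m))
        - ((\<Sum>n\<le>N. (mu * of_real (\<omega> n) - of_real (\<rho> n)) * V n * U n)
          - (\<Sum>m\<le>N. c m * left_conv ?K (\<lambda>n. U n - U (Suc n)) m))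
        = (\<Sum>n\<le>N. (lam - mu) * (of_real (\<omega> n) * U n * V n))"
      by (simp add: sum_subtractf[symmetric] algebra_simps)
  qed
  then have "(\<lambda>n. (lam - mu) * (of_real (\<omega> n) * U n * V n)) sums ((lam - mu) * 0)"
    by (simp add: sums_def_le)
  then show ?thesis
    using ne by (subst (asm) sums_mult_iff) auto
qed

text \<open>
  If the parameter were not real, the Green identity for \<open>U\<close> and its conjugate would make a series
  of nonnegative terms sum to \<open>0\<close>.
\<close>

lemma sl_system_eigenvalue_real:
  assumes "0 < q" "q < 1" "\<And>j. \<bar>K j - 1\<bar> \<le> M * q ^ j"
    and u: "sl_system K \<beta> \<rho> \<omega> \<gamma>1 \<gamma>2 lam U A b"
    and \<gamma>: "\<gamma>1 \<noteq> 0 \<or> \<gamma>2 \<noteq> 0" and \<omega>: "\<And>n. 0 < \<omega> n" and nz: "U k \<noteq> 0"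
  shows "cnj lam = lam"
proof (rule ccontr)
  assume "cnj lam \<noteq> lam"
  then have "(\<lambda>n. of_real (\<omega> n) * U n * cnj (U n)) sums 0"
    by (intro sl_system_green[OF assms(1-3) u sl_system_cnj[OF assms(1-3) u] \<gamma>]) auto
  moreover have "of_real (\<omega> n) * U n * cnj (U n) = of_real (\<omega> n * (cmod (U n))\<^sup>2)" for n
    by (simp add: complex_norm_square[symmetric] mult.assoc)
  ultimately have "(\<lambda>n. \<omega> n * (cmod (U n))\<^sup>2) sums 0"
    by (metis (no_types, lifting) sums_of_real_iff sums_cong of_real_0)
  then have "\<omega> k * (cmod (U k))\<^sup>2 = 0"
    using \<omega> by (subst (asm) sums_iff) (auto simp: suminf_eq_zero_iff less_imp_le)
  then show False
    using \<omega>[of k] nz by simp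
qed

section \<open>From the q-difference problem to the discrete system\<close>
lemma q_Gamma_pos:
  assumes "0 < q" "q < 1" "0 < \<nu>"
  shows "0 < q_Gamma q \<nu>"
proof -
  have "0 < qpoch_inf q q" "0 < qpoch_inf (q powr \<nu>) q"
    using assms by (auto intro!: qpoch_inf_pos simp: powr01_less_one)
  then show ?thesis using assms by (simp add: q_Gamma_def)
qed

lemma qpoch_0: "qpoch 0 q \<nu> = 1"
  by (simp add: qpoch_def qpoch_inf_def)

lemma qpoch_eq_0:
  assumes "0 < q" "q < 1" "z * q ^ k = 1"
  shows "qpoch z q \<nu> = 0"
  using qpoch_inf_eq_0[OF assms] by (simp add: qpoch_def)

text \<open>
  For \<open>m > n\<close> the numerator of the \<open>q\<close>-shifted factorial contains the factor
  \<open>1 - q\<^bsup>n + 1 - m\<^esup> q\<^bsup>m - n - 1\<^esup> = 0\<close>. Hence the right fractional integral is a finite sum on the grid.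
\<close>

lemma right_kernel_at_grid:
  assumes "0 < q" "q < 1" "0 < a"
  shows "qpoch (q * (a * q ^ n) / (a * q ^ m)) q (\<nu> - 1)
    = (if m \<le> n then rl_kernel q \<nu> (n - m) else 0)"
proof (cases "m \<le> n")
  case True
  then have "q ^ n = q ^ m * q ^ (n - m)"
    by (simp flip: power_add)
  then show ?thesis
    using True assms by (simp add: rl_kernel_def)
next
  case False
  then have "q ^ m = q * q ^ n * q ^ (m - Suc n)"
    by (simp flip: power_add power_Suc)
  then have "q * (a * q ^ n) / (a * q ^ m) * q ^ (m - Suc n) = 1"
    using assms by simp
  then show ?thesis
    using False qpoch_eq_0[OF assms(1,2)] by simp
qed

lemma mult_powr_pred: "0 < x \<Longrightarrow> x * x powr (\<nu> - 1) = x powr \<nu>" for x :: real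
  by (simp add: powr_mult_base)

lemma I_right_at_grid:
  assumes "0 < q" "q < 1" "0 < a"
  shows "I_right q a \<nu> f (a * q ^ n) = of_real ((1 - q) / q_Gamma q \<nu>) *
    right_conv (\<lambda>j. of_real (rl_kernel q \<nu> j)) (\<lambda>m. of_real ((a * q ^ m) powr \<nu>) * f (a * q ^ m)) n"
proof -
  have term_eq: "of_real (a * q ^ m) * right_integrand q \<nu> f (a * q ^ n) (a * q ^ m)
      = (if m \<le> n then of_real (rl_kernel q \<nu> (n - m)) * (of_real ((a * q ^ m) powr \<nu>) * f (a * q ^ m)) else 0)"
    for m
  proof -
    have pw: "a * q ^ m * (a * q ^ m) powr (\<nu> - 1) = (a * q ^ m) powr \<nu>"
      using assms by (intro mult_powr_pred) simp
    have "of_real (a * q ^ m) * right_integrand q \<nu> f (a * q ^ n) (a * q ^ m)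
      = of_real (qpoch (q * (a * q ^ n) / (a * q ^ m)) q (\<nu> - 1)) *
        (of_real (a * q ^ m * (a * q ^ m) powr (\<nu> - 1)) * f (a * q ^ m))"
      by (simp add: right_integrand_def mult_ac)
    then show ?thesis
      unfolding right_kernel_at_grid[OF assms] pw by simp
  qed
  have "jackson_integral0 q a (right_integrand q \<nu> f (a * q ^ n)) = of_real (1 - q) *
      right_conv (\<lambda>j. of_real (rl_kernel q \<nu> j)) (\<lambda>m. of_real ((a * q ^ m) powr \<nu>) * f (a * q ^ m)) n"
    unfolding jackson_integral0_def term_eq right_conv_def
    by (subst suminf_finite[of "{..n}"]) auto
  moreover have "jackson_integral0 q (q * (a * q ^ n)) (right_integrand q \<nu> f (a * q ^ n)) = 0"
  proof -
    have "of_real (q * (a * q ^ n) * q ^ k)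
        * right_integrand q \<nu> f (a * q ^ n) (q * (a * q ^ n) * q ^ k) = 0" for k
    proof -
      have shift: "q * (a * q ^ n) * q ^ k = a * q ^ (Suc n + k)"
        by (simp add: power_add)
      show ?thesis
        unfolding shift term_eq by simp
    qed
    then show ?thesis
      by (simp only: jackson_integral0_def suminf_zero mult_zero_right)
  qed
  ultimately show ?thesis
    by (simp add: I_right_def jackson_integral_def)
qed

lemma I_right_at_right_end: "0 < q \<Longrightarrow> I_right q a \<nu> f (a / q) = 0"
  by (simp add: I_right_def jackson_integral_def)

lemma right_integrand_at_0:
  assumes "0 < q" "0 < a"
  shows "of_real (a * q ^ m) * right_integrand q \<nu> f 0 (a * q ^ m)
    = of_real ((a * q ^ m) powr \<nu>) * f (a * q ^ m)"
proof -
  have pw: "a * q ^ m * (a * q ^ m) powr (\<nu> - 1) = (a * q ^ m) powr \<nu>"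
    using assms by (intro mult_powr_pred) simp
  have "of_real (a * q ^ m) * right_integrand q \<nu> f 0 (a * q ^ m)
    = of_real (a * q ^ m * (a * q ^ m) powr (\<nu> - 1)) * f (a * q ^ m)"
    by (simp add: right_integrand_def qpoch_0)
  then show ?thesis
    unfolding pw .
qed

lemma I_right_at_0:
  assumes "0 < q" "0 < a"
  shows "I_right q a \<nu> f 0 = of_real ((1 - q) / q_Gamma q \<nu>) *
    (\<Sum>m. of_real ((a * q ^ m) powr \<nu>) * f (a * q ^ m))"
  using assms
  by (simp add: I_right_def jackson_integral_def jackson_integral0_def right_integrand_at_0 del: of_real_mult)

lemma Dq_at_grid:
  assumes "0 < q" "q < 1" "0 < a"
  shows "of_real (a * q ^ n) * Dq q a f (a * q ^ n)
    = (f (a * q ^ n) - f (a * q ^ Suc n)) / of_real (1 - q)"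
proof -
  let ?x = "a * q ^ n"
  have x: "?x \<noteq> 0" using assms by simp
  have shift: "q * ?x = a * q ^ Suc n" by simp
  have "Dq q a f ?x = (f ?x - f (a * q ^ Suc n)) / (of_real (1 - q) * of_real ?x)"
    unfolding Dq_def q_quotient_def shift using x by (simp only: if_False of_real_mult)
  moreover have "complex_of_real ?x \<noteq> 0"
    using x by (simp only: of_real_eq_0_iff not_False_eq_True)
  ultimately show ?thesis
    by (simp del: of_real_mult of_real_power power_Suc)
qed

lemma cD_left_at_grid:
  assumes q: "0 < q" "q < 1" and a: "0 < a"
    and int: "jackson_integrable0 q (a * q ^ m) (left_integrand q (1 - \<alpha>) (Dq q a y) (a * q ^ m))"
  shows "cD_left q a \<alpha> y (a * q ^ m) = of_real ((a * q ^ m) powr - \<alpha> / q_Gamma q (1 - \<alpha>)) *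
    left_conv (\<lambda>j. of_real (rl_kernel q (1 - \<alpha>) j)) (\<lambda>n. y (a * q ^ n) - y (a * q ^ Suc n)) m"
proof -
  let ?x = "a * q ^ m"
  have x: "?x \<noteq> 0" using q a by simp
  have "of_real (1 - q) * (of_real (?x * q ^ j) * left_integrand q (1 - \<alpha>) (Dq q a y) ?x (?x * q ^ j))
     = of_real (rl_kernel q (1 - \<alpha>) j) * (y (a * q ^ (m + j)) - y (a * q ^ Suc (m + j)))"
    for j
  proof -
    have shift: "?x * q ^ j = a * q ^ (m + j)"
      by (simp add: power_add)
    have ratio: "q * (?x * q ^ j) / ?x = q ^ Suc j"
      using x by simp
    have "of_real (?x * q ^ j) * left_integrand q (1 - \<alpha>) (Dq q a y) ?x (?x * q ^ j)
        = of_real (rl_kernel q (1 - \<alpha>) j) * (of_real (a * q ^ (m + j)) * Dq q a y (a * q ^ (m + j)))"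
      unfolding left_integrand_def rl_kernel_def ratio
      unfolding shift by (rule mult.left_commute)
    then show ?thesis
      using q by (simp only: Dq_at_grid[OF q a]) simp
  qed
  moreover have "jackson_integral0 q ?x (left_integrand q (1 - \<alpha>) (Dq q a y) ?x)
     = (\<Sum>j. of_real (1 - q) * (of_real (?x * q ^ j) * left_integrand q (1 - \<alpha>) (Dq q a y) ?x (?x * q ^ j)))"
    unfolding jackson_integral0_def
    using int by (intro suminf_mult[symmetric]) (simp only: jackson_integrable0_def)
  ultimately have "jackson_integral0 q ?x (left_integrand q (1 - \<alpha>) (Dq q a y) ?x)
     = left_conv (\<lambda>j. of_real (rl_kernel q (1 - \<alpha>) j)) (\<lambda>n. y (a * q ^ n) - y (a * q ^ Suc n)) m"
    by (simp only: left_conv_def)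
  moreover have "1 - \<alpha> - 1 = - \<alpha>" by simp
  ultimately show ?thesis
    using x by (simp only: cD_left_def I_left_def I_left_formula_def if_False)
qed

text \<open>
  The factor \<open>- 1 / q\<close> turns the \<open>q\<^sup>-\<^sup>1\<close>-difference quotient into a backward difference with
  denominator \<open>(1 - q) x\<close>; at the first grid point the subtracted value is that at \<open>a / q\<close>.
\<close>

lemma D_right_at_grid:
  assumes "0 < q" "q < 1" "0 < a"
  shows "of_real ((1 - q) * (a * q ^ n)) * D_right q a \<alpha> f (a * q ^ n)
    = I_right q a (1 - \<alpha>) f (a * q ^ n)
      - (case n of 0 \<Rightarrow> 0 | Suc k \<Rightarrow> I_right q a (1 - \<alpha>) f (a * q ^ k))"
proof -
  let ?R = "I_right q a (1 - \<alpha>) f"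
  let ?x = "a * q ^ n"
  have x: "?x \<noteq> 0" using assms by simp
  have "?R (?x / q) = (case n of 0 \<Rightarrow> 0 | Suc k \<Rightarrow> ?R (a * q ^ k))"
    using assms by (cases n) (simp_all add: I_right_at_right_end mult_ac)
  moreover have "of_real ((1 - q) * ?x) * D_right q a \<alpha> f ?x = ?R ?x - ?R (?x / q)"
  proof -
    have "D_right q a \<alpha> f ?x = - of_real (1 / q) * ((?R ?x - ?R (?x / q)) / of_real ((1 - 1 / q) * ?x))"
      using x by (simp add: D_right_def Dq_inv_def q_quotient_def)
    also have "\<dots> = (?R ?x - ?R (?x / q)) * of_real (- (1 / q) / ((1 - 1 / q) * ?x))"
      by simp
    also have "- (1 / q) / ((1 - 1 / q) * ?x) = 1 / ((1 - q) * ?x)"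
    proof -
      have flip: "q * (1 - 1 / q) = - (1 - q)"
        using assms by (simp add: field_simps)
      have "- (1 / q) / ((1 - 1 / q) * ?x) = - 1 / (q * (1 - 1 / q) * ?x)"
        by (simp add: mult.assoc)
      then show ?thesis
        unfolding flip by (simp only: mult_minus_left minus_divide_divide)
    qed
    finally show ?thesis
      using x assms by (simp del: of_real_mult)
  qed
  ultimately show ?thesis by simp
qed

lemma qfsl_solution_imp_sl_system:
  assumes q: "0 < q" "q < 1" and a: "0 < a" and \<alpha>: "0 < \<alpha>" "\<alpha> < 1"
    and sol: "qfsl_solution q a \<alpha> p r w c1 c2 d1 d2 lam y"
  defines "C \<equiv> (1 - q) / q_Gamma q (1 - \<alpha>)"
  shows "sl_system (rl_kernel q (1 - \<alpha>))
     (\<lambda>m. (a * q ^ m) powr (1 - \<alpha>) * p (a * q ^ m) * ((a * q ^ m) powr - \<alpha> / q_Gamma q (1 - \<alpha>)))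
     (\<lambda>n. (1 - q) * (a * q ^ n) * r (a * q ^ n) / C)
     (\<lambda>n. (1 - q) * (a * q ^ n) * w (a * q ^ n) / C)
     c1 (c2 * C) lam (\<lambda>n. y (a * q ^ n)) (y 0)
     (\<lambda>m. of_real ((a * q ^ m) powr (1 - \<alpha>)) * p_cD q a \<alpha> p y (a * q ^ m))"
proof -
  let ?f = "p_cD q a \<alpha> p y"
  define b where "b = (\<lambda>m. of_real ((a * q ^ m) powr (1 - \<alpha>)) * ?f (a * q ^ m))"
  have C: "C \<noteq> 0"
    using q q_Gamma_pos[OF q, of "1 - \<alpha>"] \<alpha> by (simp add: C_def)
  have mem: "a * q ^ n \<in> Aq_star q a" for n
    by (auto simp: Aq_star_def Aq_def)
  have "(\<lambda>n. y (a * q ^ n)) \<longlonglongrightarrow> y 0"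
    using sol mem[of 0] by (auto simp: qfsl_solution_def q_regular_at_zero_def)
  moreover have "summable b"
  proof -
    have "jackson_integrable q (q * 0) a (right_integrand q (1 - \<alpha>) ?f 0)"
      using sol by (auto simp: qfsl_solution_def qfsl_defined_def Aq_star_def)
    then show ?thesis
      using q a by (simp add: jackson_integrable_def jackson_integrable0_def b_def
          right_integrand_at_0 del: of_real_mult)
  qed
  moreover have "of_real c1 * y 0 + of_real (c2 * C) * suminf b = 0"
    using sol I_right_at_0[OF q(1) a, of "1 - \<alpha>" ?f]
    by (simp add: qfsl_solution_def C_def b_def mult.assoc)
  moreover have "b m = of_real ((a * q ^ m) powr (1 - \<alpha>) * p (a * q ^ m) * ((a * q ^ m) powr - \<alpha> / q_Gamma q (1 - \<alpha>)))
      * left_conv (\<lambda>j. of_real (rl_kernel q (1 - \<alpha>) j)) (\<lambda>n. y (a * q ^ n) - y (a * q ^ Suc n)) m" for m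
  proof -
    have "jackson_integrable0 q (a * q ^ m) (left_integrand q (1 - \<alpha>) (Dq q a y) (a * q ^ m))"
      using sol by (auto simp: qfsl_solution_def qfsl_defined_def Aq_def)
    from cD_left_at_grid[OF q a this] show ?thesis
      by (simp only: b_def p_cD_def of_real_mult mult.assoc)
  qed
  moreover have "right_conv (\<lambda>j. of_real (rl_kernel q (1 - \<alpha>) j)) b n
      - (case n of 0 \<Rightarrow> 0 | Suc k \<Rightarrow> right_conv (\<lambda>j. of_real (rl_kernel q (1 - \<alpha>) j)) b k)
      = (lam * of_real ((1 - q) * (a * q ^ n) * w (a * q ^ n) / C)
         - of_real ((1 - q) * (a * q ^ n) * r (a * q ^ n) / C)) * y (a * q ^ n)" (is "?D = _") for n
  proof -
    let ?x = "a * q ^ n"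
    have "D_right q a \<alpha> ?f ?x = (lam * of_real (w ?x) - of_real (r ?x)) * y ?x"
      using sol mem[of n] by (auto simp: qfsl_solution_def algebra_simps)
    moreover have "of_real ((1 - q) * ?x) * D_right q a \<alpha> ?f ?x = of_real C * ?D"
      unfolding D_right_at_grid[OF q a] I_right_at_grid[OF q a] C_def b_def
      by (simp add: right_diff_distrib split: nat.splits)
    ultimately have "of_real C * ?D = of_real ((1 - q) * ?x) * ((lam * of_real (w ?x) - of_real (r ?x)) * y ?x)"
      by simp
    then have "?D = of_real ((1 - q) * ?x) * ((lam * of_real (w ?x) - of_real (r ?x)) * y ?x) / of_real C"
      using C by (simp add: nonzero_eq_divide_eq mult.commute)
    moreover have "X * ((lam * W - R) * Y) / Z = (lam * (X * W / Z) - X * R / Z) * Y"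
      for X Y Z W R :: complex
      by (simp add: algebra_simps diff_divide_distrib)
    ultimately show ?thesis
      by (simp only: of_real_mult of_real_divide)
  qed
  ultimately show ?thesis
    unfolding sl_system_def b_def by blast
qed

theorem lemma3p4:
  fixes q a \<alpha> c1 c2 d1 d2 :: real
    and p r w :: "real \<Rightarrow> real"
    and lam mu :: complex
    and u v :: "real \<Rightarrow> complex"
  assumes "0 < q" and "q < 1" and "0 < a" and "0 < \<alpha>" and "\<alpha> < 1"
    and "\<And>x. x \<in> Aq_star q a \<Longrightarrow> p x \<noteq> 0"
    and "\<And>x. x \<in> Aq_star q a \<Longrightarrow> 0 < w x"
    and "c1\<^sup>2 + c2\<^sup>2 \<noteq> 0" and "d1\<^sup>2 + d2\<^sup>2 \<noteq> 0"
    and "qfsl_eigenfunction q a \<alpha> p r w c1 c2 d1 d2 lam u"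
    and "qfsl_eigenfunction q a \<alpha> p r w c1 c2 d1 d2 mu v"
    and "lam \<noteq> mu"
  shows "q_orthogonal q a w u v"
proof -
  note q = assms(1,2) and a = assms(3) and \<alpha> = assms(4,5)
  let ?x = "\<lambda>n. a * q ^ n"
  define C where "C = (1 - q) / q_Gamma q (1 - \<alpha>)"
  define \<omega> where "\<omega> n = (1 - q) * ?x n * w (?x n) / C" for n
  have C: "0 < C"
    using q q_Gamma_pos[OF q, of "1 - \<alpha>"] \<alpha> by (simp add: C_def)
  have \<omega>: "0 < \<omega> n" for n
  proof -
    have "0 < w (?x n)"
      by (rule assms(7)) (auto simp: Aq_star_def Aq_def)
    then show ?thesis
      using q a C by (simp add: \<omega>_def)
  qed
  have \<gamma>: "c1 \<noteq> 0 \<or> c2 * C \<noteq> 0"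
    using assms(8) C by auto
  obtain M where M: "\<And>j. \<bar>rl_kernel q (1 - \<alpha>) j - 1\<bar> \<le> M * q ^ j"
    using rl_kernel_minus_1_bound[OF q, of "1 - \<alpha>"] \<alpha> by auto
  have solu: "qfsl_solution q a \<alpha> p r w c1 c2 d1 d2 lam u"
    and solv: "qfsl_solution q a \<alpha> p r w c1 c2 d1 d2 mu v"
    using assms(10,11) by (auto simp: qfsl_eigenfunction_def)
  note su = qfsl_solution_imp_sl_system[OF q a \<alpha> solu, folded C_def, folded \<omega>_def]
  note sv = qfsl_solution_imp_sl_system[OF q a \<alpha> solv, folded C_def, folded \<omega>_def]
  \<comment> \<open>By regularity at zero, a function that vanishes at every \<open>a q\<^sup>n\<close> also vanishes at \<open>0\<close>.\<close>
  obtain k where "v (?x k) \<noteq> 0"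
  proof (rule ccontr)
    assume "\<not> thesis"
    then have zero: "v (?x n) = 0" for n
      using that by blast
    then have "v 0 = 0"
      using sv by (simp add: sl_system_def LIMSEQ_const_iff)
    then show False
      using assms(11) zero by (auto simp: qfsl_eigenfunction_def Aq_star_def Aq_def)
  qed
  then have "cnj mu = mu"
    by (rule sl_system_eigenvalue_real[OF q M sv \<gamma> \<omega>])
  with assms(12) have "lam \<noteq> cnj mu" by simp
  \<comment> \<open>The factor undoes the normalisation of \<open>\<omega>\<close>, leaving the weights of the Jackson integral.\<close>
  from sl_system_green[OF q M su sl_system_cnj[OF q M sv] \<gamma> this]
  have "(\<lambda>n. of_real (C / (1 - q)) * (of_real (\<omega> n) * u (?x n) * cnj (v (?x n)))) sums (of_real (C / (1 - q)) * 0)"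
    by (rule sums_mult)
  moreover have "of_real (C / (1 - q)) * (of_real (\<omega> n) * u (?x n) * cnj (v (?x n)))
      = of_real (?x n) * (u (?x n) * cnj (v (?x n)) * of_real (w (?x n)))" for n
  proof -
    have "C / (1 - q) * \<omega> n = ?x n * w (?x n)"
      using C q by (simp add: \<omega>_def)
    then have "of_real (C / (1 - q)) * of_real (\<omega> n) = (of_real (?x n) * of_real (w (?x n)) :: complex)"
      by (metis of_real_mult)
    then show ?thesis
      by (simp only: mult.assoc[symmetric]) (simp only: mult_ac)
  qed
  ultimately have "(\<lambda>n. of_real (?x n) * (u (?x n) * cnj (v (?x n)) * of_real (w (?x n)))) sums 0"
    by simp
  then show ?thesis
    by (simp add: q_orthogonal_def q_inner_def jackson_integrable0_def jackson_integral0_def sums_iff)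
qed

end
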